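(* For any $\alpha>0$, there exists $C>0$ such that the following holds. Let $G$ be an $n$-vertex graph admitting an edge coloring with $n$ colors such that each color class has size at least two. If there are at least $\alpha n$ color classes each of which contains either a matching of size two or a triangle, then the rainbow girth of $G$ is at most $C\log n$.
   Context: An edge coloring of a graph $G$ with $m$ colors is any map $\lambda:E(G)\to[m]$ (not necessarily proper); for $i\in[m]$ the set $\lambda^{-1}(i)$ is a color class. A subgraph of $G$ is rainbow if no two of its edges lie in the same color class. The rainbow girth of $G$ is the minimum length of a rainbow cycle in $G$ ($\infty$ if none exists). A matching of size two is a pair of vertex-disjoint edges; a color class contains a triangle if it contains the three edges of some triangle. *)

theory Defs
  imports Complex_Main "HOL-Library.Extended_Real"
begin

text \<open>
  Finite simple graphs are given by a vertex set and a set of two-element edges. The vertex set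
  is required to be nonempty, as usual; this matters below because the null graph has no cycle
  but vacuously satisfies any condition imposed on each of its zero color classes.
\<close>

definition finite_simple_graph :: "'a set \<Rightarrow> 'a set set \<Rightarrow> bool" where
  "finite_simple_graph V E \<longleftrightarrow>
     finite V \<and> V \<noteq> {} \<and> (\<forall>e\<in>E. e \<subseteq> V \<and> card e = 2)"

definition edge_coloring :: "'a set set \<Rightarrow> nat \<Rightarrow> ('a set \<Rightarrow> nat) \<Rightarrow> bool" where
  "edge_coloring E m col \<longleftrightarrow> col ` E \<subseteq> {1..m}"

definition color_class :: "'a set set \<Rightarrow> ('a set \<Rightarrow> nat) \<Rightarrow> nat \<Rightarrow> 'a set set" where
  "color_class E col i = {e \<in> E. col e = i}"

definition rainbow :: "('a set \<Rightarrow> nat) \<Rightarrow> 'a set set \<Rightarrow> bool" where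
  "rainbow col F \<longleftrightarrow> inj_on col F"

text \<open>
  A cycle is represented by a list of its vertices in cyclic order. The index is taken modulo
  the length so that the edge joining the last vertex to the first is included.
\<close>

definition cycle_edges :: "'a list \<Rightarrow> 'a set set" where
  "cycle_edges vs = {{vs ! i, vs ! (Suc i mod length vs)} | i. i < length vs}"

definition is_cycle :: "'a set set \<Rightarrow> 'a list \<Rightarrow> bool" where
  "is_cycle E vs \<longleftrightarrow> 3 \<le> length vs \<and> distinct vs \<and> cycle_edges vs \<subseteq> E"

text \<open>The infimum of the empty set of type \<open>enat\<close> is \<open>\<infinity>\<close>.\<close>

definition rainbow_girth :: "'a set set \<Rightarrow> ('a set \<Rightarrow> nat) \<Rightarrow> enat" where
  "rainbow_girth E col =
     Inf {enat (length vs) | vs. is_cycle E vs \<and> rainbow col (cycle_edges vs)}"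

definition contains_matching_of_size_two :: "'a set set \<Rightarrow> bool" where
  "contains_matching_of_size_two F \<longleftrightarrow> (\<exists>e\<in>F. \<exists>f\<in>F. e \<noteq> f \<and> e \<inter> f = {})"

definition contains_triangle :: "'a set set \<Rightarrow> bool" where
  "contains_triangle F \<longleftrightarrow>
     (\<exists>x y z. x \<noteq> y \<and> y \<noteq> z \<and> x \<noteq> z \<and> {x, y} \<in> F \<and> {y, z} \<in> F \<and> {x, z} \<in> F)"

end

theory Submission imports Defs
begin

text \<open>
  Delete each vertex independently with a small probability \<open>q\<close>. A color class made of two incident
  edges keeps an edge with probability \<open>(1 - q) (1 - q\<^sup>2)\<close>, just short of the survival probability
  \<open>1 - q\<close> of a vertex, whereas a matching or a triangle does so with probability \<open>1 - O(q\<^sup>2)\<close>.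
  As a positive fraction of the classes is of the second kind, some surviving vertex set \<open>U\<close> contains
  edges of at least \<open>|U| + \<epsilon> n\<close> distinct colors. One edge for each of these colors gives a rainbow
  graph with at least \<open>(1 + \<epsilon>) |U|\<close> edges. In a minimal subgraph of this density every vertex set
  \<open>S\<close> meets at least \<open>(1 + \<epsilon>) |S|\<close> edges, so balls whose breadth-first tree closes no cycle grow
  exponentially, and a cycle must appear within logarithmic radius.
\<close>

section \<open>Short cycles in graphs with linearly many excess edges\<close>

text \<open>A repeated vertex lets the segment between its two occurrences be cut out, so induction
  on length reduces the walk to a path. The edge \<open>{x, y}\<close> closes that path, and since
  it lies outside \<open>F\<close> the result is not degenerate. Lengths count vertices.\<close>

lemma cycle_from_walk:
  assumes "F \<subseteq> E" "{x, y} \<in> E" "{x, y} \<notin> F" "x \<noteq> y"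
    and "successively (\<lambda>a b. {a, b} \<in> F) xs" "xs \<noteq> []" "hd xs = x" "last xs = y"
  shows "\<exists>vs. is_cycle E vs \<and> length vs \<le> length xs"
  using assms(5-8)
proof (induction "length xs" arbitrary: xs rule: less_induct)
  case less
  show ?case
  proof (cases "distinct xs")
    case False
    then obtain us a vs ws where xs: "xs = us @ [a] @ vs @ [a] @ ws"
      using not_distinct_decomp by blast
    let ?ys = "us @ [a] @ ws"
    have "successively (\<lambda>a b. {a, b} \<in> F) ?ys"
      using less.prems(1) unfolding xs by (auto simp: successively_append_iff successively_Cons)
    moreover have "hd ?ys = x" "last ?ys = y"
      using less.prems unfolding xs by (auto simp: hd_append)
    ultimately obtain zs where "is_cycle E zs" "length zs \<le> length ?ys"
      using less.hyps[of ?ys] xs by auto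
    then show ?thesis
      using xs by force
  next
    case True
    have nth: "{xs ! i, xs ! Suc i} \<in> F" if "Suc i < length xs" for i
      using less.prems(1) that by (simp add: successively_conv_nth)
    \<comment> \<open>One vertex would force \<open>x = y\<close>, and two would put
      \<open>{x, y}\<close> into \<open>F\<close>.\<close>
    have "length xs \<noteq> 0" "length xs \<noteq> 1"
      using less.prems assms(4) by (auto simp: length_Suc_conv)
    moreover have "length xs \<noteq> 2"
      using less.prems assms(3) by (auto simp: numeral_2_eq_2 length_Suc_conv)
    ultimately have len: "3 \<le> length xs" by linarith
    have "{xs ! i, xs ! (Suc i mod length xs)} \<in> E" if "i < length xs" for i
    proof (cases "Suc i < length xs")
      case True
      then show ?thesis using nth assms(1) by auto
    next
      case False
      then have "Suc i = length xs" using that by simp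
      then have "xs ! i = y" "xs ! (Suc i mod length xs) = x"
        using less.prems by (auto simp: last_conv_nth hd_conv_nth simp flip: \<open>Suc i = length xs\<close>)
      then show ?thesis using assms(2) by (simp add: insert_commute)
    qed
    then have "is_cycle E xs"
      using True len by (auto simp: is_cycle_def cycle_edges_def)
    then show ?thesis by blast
  qed
qed

text \<open>\<open>B\<close> plays the ball of radius \<open>r\<close> around \<open>v\<close> and
  \<open>F\<close> its breadth-first tree; of the tree property only \<open>card F < card B\<close>
  and short walks from \<open>v\<close> are kept. If every edge meeting \<open>B\<close> belongs to
  the tree grown by one layer, expansion makes the next ball larger by a factor \<open>c\<close>;
  any other edge meeting \<open>B\<close> closes a short cycle.\<close>

lemma ball_growth:
  fixes c :: real
  assumes W: "finite W" "v \<in> W" and E: "\<And>e. e \<in> E \<Longrightarrow> e \<subseteq> W \<and> card e = 2"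
    and expand: "\<And>S. S \<subseteq> W \<Longrightarrow> S \<noteq> {} \<Longrightarrow> c * real (card S) \<le> real (card {e \<in> E. e \<inter> S \<noteq> {}})"
    and c: "c \<ge> 0"
  shows "(\<exists>vs. is_cycle E vs \<and> length vs \<le> 2 * r + 1) \<or>
    (\<exists>B F. v \<in> B \<and> B \<subseteq> W \<and> F \<subseteq> E \<and> card F < card B \<and> c ^ r \<le> real (card B) \<and>
      (\<forall>x\<in>B. \<exists>xs. successively (\<lambda>a b. {a, b} \<in> F) xs \<and> xs \<noteq> [] \<and> hd xs = v \<and> last xs = x \<and>
         length xs \<le> Suc r))"
proof (induction r)
  case 0
  show ?case
    using W by (intro disjI2 exI[of _ "{v}"] exI[of _ "{}"]) (auto intro!: exI[of _ "[v]"])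
next
  case (Suc r)
  show ?case
  proof (cases "\<exists>vs. is_cycle E vs \<and> length vs \<le> 2 * r + 1")
    case True
    then show ?thesis by force
  next
    case False
    with Suc obtain B F where B: "v \<in> B" "B \<subseteq> W" and F: "F \<subseteq> E" "card F < card B"
      and card: "c ^ r \<le> real (card B)"
      and walk: "\<And>x. x \<in> B \<Longrightarrow> \<exists>xs. successively (\<lambda>a b. {a, b} \<in> F) xs \<and> xs \<noteq> [] \<and> hd xs = v \<and>
        last xs = x \<and> length xs \<le> Suc r"
      by auto
    have finE: "finite E"
      using E W(1) by (intro finite_subset[of E "Pow W"]) auto
    have finB: "finite B" using B(2) W(1) finite_subset by blast
    \<comment> \<open>The next layer; each of its vertices is attached to the tree by a single edge
      to a parent \<open>p u\<close>.\<close>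
    define N where "N = {u \<in> W - B. \<exists>b\<in>B. {b, u} \<in> E}"
    have finN: "finite N" using W(1) by (simp add: N_def)
    have "\<forall>u\<in>N. \<exists>b. b \<in> B \<and> {b, u} \<in> E" by (auto simp: N_def)
    then obtain p where p: "\<And>u. u \<in> N \<Longrightarrow> p u \<in> B \<and> {p u, u} \<in> E"
      by (meson bchoice)
    define F' where "F' = F \<union> (\<lambda>u. {p u, u}) ` N"
    have F': "F' \<subseteq> E" using F(1) p by (auto simp: F'_def)
    have "card F' \<le> card F + card N"
      unfolding F'_def using finN by (meson card_Un_le card_image_le add_left_mono le_trans)
    also have "\<dots> < card B + card N" using F(2) by simp
    also have "\<dots> = card (B \<union> N)"
      using finB finN by (subst card_Un_disjoint) (auto simp: N_def)
    finally have card': "card F' < card (B \<union> N)" .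
    have walk': "\<exists>xs. successively (\<lambda>a b. {a, b} \<in> F') xs \<and> xs \<noteq> [] \<and> hd xs = v \<and>
        last xs = x \<and> length xs \<le> Suc (Suc r)" if "x \<in> B \<union> N" for x
    proof (cases "x \<in> B")
      case True
      from walk[OF this] obtain xs where xs: "successively (\<lambda>a b. {a, b} \<in> F) xs" "xs \<noteq> []"
        "hd xs = v" "last xs = x" "length xs \<le> Suc r" by blast
      have "successively (\<lambda>a b. {a, b} \<in> F') xs"
        using xs(1) by (rule successively_mono) (auto simp: F'_def)
      then show ?thesis using xs by auto
    next
      case False
      with that have x: "x \<in> N" by simp
      with p have "p x \<in> B" by blast
      from walk[OF this] obtain xs where xs: "successively (\<lambda>a b. {a, b} \<in> F) xs" "xs \<noteq> []"
        "hd xs = v" "last xs = p x" "length xs \<le> Suc r" by blast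
      have "successively (\<lambda>a b. {a, b} \<in> F') xs"
        using xs(1) by (rule successively_mono) (auto simp: F'_def)
      then have "successively (\<lambda>a b. {a, b} \<in> F') (xs @ [x])"
        using xs x by (auto simp: successively_append_iff F'_def)
      then show ?thesis using xs by (intro exI[of _ "xs @ [x]"]) auto
    qed
    let ?T = "{e \<in> E. e \<inter> B \<noteq> {}}"
    show ?thesis
    proof (cases "?T \<subseteq> F'")
      case True
      have "c ^ Suc r \<le> c * real (card B)" using card c by (simp add: mult_left_mono)
      also have "\<dots> \<le> real (card ?T)" using expand B by blast
      also have "\<dots> \<le> real (card F')"
        using True F' finE by (simp add: card_mono finite_subset)
      also have "\<dots> \<le> real (card (B \<union> N))" using card' by simp
      finally show ?thesis
        using B F' card' walk'
        by (intro disjI2 exI[of _ "B \<union> N"] exI[of _ F']) (auto simp: N_def)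
    next
      case False
      then obtain e where e: "e \<in> E" "e \<inter> B \<noteq> {}" "e \<notin> F'" by blast
      then obtain x where x: "x \<in> e" "x \<in> B" by blast
      from E[OF e(1)] obtain y where y: "e = {x, y}" "x \<noteq> y" "y \<in> W"
        using x(1) by (auto simp: card_2_iff)
      have "y \<in> B \<union> N" using x y e by (auto simp: N_def)
      from walk'[OF this] obtain ys where ys: "successively (\<lambda>a b. {a, b} \<in> F') ys" "ys \<noteq> []"
        "hd ys = v" "last ys = y" "length ys \<le> Suc (Suc r)" by blast
      from walk'[of x] x obtain xs where xs: "successively (\<lambda>a b. {a, b} \<in> F') xs" "xs \<noteq> []"
        "hd xs = v" "last xs = x" "length xs \<le> Suc (Suc r)" by blast
      \<comment> \<open>The root is dropped from one of the two walks, as \<open>rev xs\<close>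
        already ends in it. This leaves at most \<open>2 * (r + 2) - 1 = 2 * Suc r + 1\<close>
        vertices.\<close>
      obtain zs where zs: "ys = v # zs" using ys by (cases ys) auto
      let ?ws = "rev xs @ zs"
      have "successively (\<lambda>a b. {a, b} \<in> F') ?ws"
        using xs ys zs
        by (auto simp: successively_append_iff successively_Cons last_rev insert_commute)
      moreover have "hd ?ws = x" "last ?ws = y"
        using xs ys zs by (auto simp: hd_append hd_rev last_rev)
      ultimately obtain vs where "is_cycle E vs" "length vs \<le> length ?ws"
        using cycle_from_walk[OF F', of x y ?ws] e y xs(2) by auto
      then show ?thesis
        using xs(5) ys(5) zs by (intro disjI1 exI[of _ vs]) auto
    qed
  qed
qed

text \<open>In a smallest nonempty vertex set of edge density at least \<open>c\<close>, deleting a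
  proper part \<open>S\<close> must destroy more than \<open>c * card S\<close> edges, since
  otherwise the remainder would be a smaller such set. This is the expansion that
  \<open>ball_growth\<close> needs, and the choice of \<open>r\<close> leaves no room for its
  ball.\<close>

lemma dense_graph_has_short_cycle:
  fixes c :: real
  assumes U: "finite U" and E: "\<And>e. e \<in> E \<Longrightarrow> e \<subseteq> U \<and> card e = 2" and "E \<noteq> {}"
    and dense: "c * real (card U) \<le> real (card E)" and c: "c \<ge> 0" and r: "real (card U) < c ^ r"
  shows "\<exists>vs. is_cycle E vs \<and> length vs \<le> 2 * r + 1"
proof -
  let ?P = "\<lambda>W. W \<subseteq> U \<and> W \<noteq> {} \<and> c * real (card W) \<le> real (card {e \<in> E. e \<subseteq> W})"
  have "U \<noteq> {}" using E \<open>E \<noteq> {}\<close> by fastforce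
  moreover have "{e \<in> E. e \<subseteq> U} = E" using E by auto
  ultimately have "?P U" using dense by simp
  from ex_has_least_nat[of ?P U card, OF this]
  obtain W where W: "?P W" and least: "\<And>X. ?P X \<Longrightarrow> card W \<le> card X" by blast
  define H where "H = {e \<in> E. e \<subseteq> W}"
  have finW: "finite W" using W U finite_subset by blast
  have expand: "c * real (card S) \<le> real (card {e \<in> H. e \<inter> S \<noteq> {}})"
    if S: "S \<subseteq> W" "S \<noteq> {}" for S
  proof (cases "S = W")
    \<comment> \<open>Treated apart because \<open>W - S\<close> would be empty, and minimality says
      nothing about the empty set.\<close>
    case True
    have "e \<inter> W \<noteq> {}" if "e \<in> H" for e
      using that E[of e] by (auto simp: H_def Int_absorb2)
    then have "{e \<in> H. e \<inter> W \<noteq> {}} = H" by blast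
    then show ?thesis using True W by (simp add: H_def)
  next
    case False
    have "card (W - S) < card W"
      using S finW by (intro psubset_card_mono) auto
    then have "\<not> ?P (W - S)"
      using least[of "W - S"] by linarith
    moreover have "W - S \<subseteq> U" "W - S \<noteq> {}" using W S False by auto
    ultimately have "real (card {e \<in> E. e \<subseteq> W - S}) < c * real (card (W - S))" by auto
    also have "card (W - S) = card W - card S"
      using S finW by (simp add: card_Diff_subset finite_subset)
    also have "real (card W - card S) = real (card W) - real (card S)"
      using S finW by (simp add: card_mono of_nat_diff)
    finally have "real (card {e \<in> E. e \<subseteq> W - S}) + c * real (card S) < c * real (card W)"
      by (simp add: algebra_simps)
    also have "\<dots> \<le> real (card H)" using W by (simp add: H_def)
    also have "H = {e \<in> E. e \<subseteq> W - S} \<union> {e \<in> H. e \<inter> S \<noteq> {}}"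
      by (auto simp: H_def)
    also have "real (card \<dots>) \<le> real (card {e \<in> E. e \<subseteq> W - S}) + real (card {e \<in> H. e \<inter> S \<noteq> {}})"
      using card_Un_le[of "{e \<in> E. e \<subseteq> W - S}" "{e \<in> H. e \<inter> S \<noteq> {}}"] by linarith
    finally show ?thesis by simp
  qed
  obtain v where v: "v \<in> W" using W by blast
  have H: "e \<subseteq> W \<and> card e = 2" if "e \<in> H" for e using that E by (auto simp: H_def)
  have small: "\<not> c ^ r \<le> real (card B)" if "B \<subseteq> W" for B
  proof -
    have "card B \<le> card U" using that W U by (intro card_mono) auto
    then show ?thesis using r by linarith
  qed
  have "\<exists>vs. is_cycle H vs \<and> length vs \<le> 2 * r + 1"
    using ball_growth[OF finW v H expand c, of r] small by metis
  moreover have "H \<subseteq> E" by (auto simp: H_def)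
  ultimately show ?thesis unfolding is_cycle_def by blast
qed

section \<open>Random vertex deletion\<close>

text \<open>For \<open>U\<close> inside \<open>V\<close>, the probability that exactly
  \<open>U\<close> survives when each vertex is kept independently with probability
  \<open>p\<close>; thus \<open>p\<close> is \<open>1 - q\<close> for the deletion probability
  \<open>q\<close>.\<close>

definition survival_weight :: "real \<Rightarrow> 'a set \<Rightarrow> 'a set \<Rightarrow> real" where
  "survival_weight p V U = p ^ card U * (1 - p) ^ card (V - U)"

text \<open>Each vertex contributes a factor \<open>p + (1 - p)\<close>, with the second summand
  replaced by 0 on \<open>A\<close>. Expanding the product over subsets kills exactly the terms that
  omit a vertex of \<open>A\<close>.\<close>

lemma sum_survival_weight_superset:
  assumes "finite V" "A \<subseteq> V"
  shows "(\<Sum>U\<in>Pow V. survival_weight p V U * of_bool (A \<subseteq> U)) = p ^ card A"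
proof -
  have "p ^ card A = (\<Prod>x\<in>V. if x \<in> A then p else 1)"
    using assms by (simp add: prod.If_cases Int_absorb1)
  also have "\<dots> = (\<Prod>x\<in>V. p + (if x \<in> A then 0 else 1 - p))"
    by (intro prod.cong) auto
  also have "\<dots> = (\<Sum>U\<in>Pow V. (\<Prod>x\<in>U. p) * (\<Prod>x\<in>V - U. if x \<in> A then 0 else 1 - p))"
    using assms(1) by (rule prod_add)
  also have "\<dots> = (\<Sum>U\<in>Pow V. survival_weight p V U * of_bool (A \<subseteq> U))"
  proof (rule sum.cong)
    fix U assume "U \<in> Pow V"
    show "(\<Prod>x\<in>U. p) * (\<Prod>x\<in>V - U. if x \<in> A then 0 else 1 - p) =
        survival_weight p V U * of_bool (A \<subseteq> U)"
    proof (cases "A \<subseteq> U")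
      case True
      then have "(\<Prod>x\<in>V - U. if x \<in> A then 0 else 1 - p) = (\<Prod>x\<in>V - U. 1 - p)"
        by (intro prod.cong) auto
      then show ?thesis using True by (simp add: survival_weight_def)
    next
      case False
      then have "(\<Prod>x\<in>V - U. if x \<in> A then 0 else 1 - p) = 0"
        using assms by (intro prod_zero) auto
      then show ?thesis using False by simp
    qed
  qed simp
  finally show ?thesis by simp
qed

lemma survival_weight_nonneg: "0 \<le> p \<Longrightarrow> p \<le> 1 \<Longrightarrow> 0 \<le> survival_weight p V U"
  by (simp add: survival_weight_def)

text \<open>Linearity of expectation over the indicators of single vertices.\<close>

lemma sum_survival_weight_card:
  assumes "finite V"
  shows "(\<Sum>U\<in>Pow V. survival_weight p V U * real (card U)) = p * real (card V)"
proof -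
  have "(\<Sum>U\<in>Pow V. survival_weight p V U * real (card U)) =
      (\<Sum>U\<in>Pow V. \<Sum>x\<in>V. survival_weight p V U * of_bool ({x} \<subseteq> U))"
  proof (rule sum.cong)
    fix U assume "U \<in> Pow V"
    then have "real (card U) = (\<Sum>x\<in>V. of_bool ({x} \<subseteq> U))"
      using assms by (simp add: of_bool_def sum.If_cases Int_absorb1)
    then show "survival_weight p V U * real (card U) =
        (\<Sum>x\<in>V. survival_weight p V U * of_bool ({x} \<subseteq> U))"
      by (simp add: sum_distrib_left)
  qed simp
  also have "\<dots> = (\<Sum>x\<in>V. \<Sum>U\<in>Pow V. survival_weight p V U * of_bool ({x} \<subseteq> U))"
    by (rule sum.swap)
  also have "\<dots> = (\<Sum>x\<in>V. p)"
    using sum_survival_weight_superset[OF assms, of "{_}" p] by (intro sum.cong refl) auto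
  finally show ?thesis by simp
qed

text \<open>The probability that some edge of \<open>F\<close> survives the random deletion.\<close>

definition hit_weight :: "real \<Rightarrow> 'a set \<Rightarrow> 'a set set \<Rightarrow> real" where
  "hit_weight p V F = (\<Sum>U\<in>Pow V. survival_weight p V U * of_bool (\<exists>e\<in>F. e \<subseteq> U))"

text \<open>Inclusion-exclusion for the survival of \<open>e\<close> or \<open>f\<close>, applied
  pointwise in \<open>U\<close>.\<close>

lemma hit_weight_two_edges:
  assumes "finite V" "0 \<le> p" "p \<le> 1" "e \<in> F" "f \<in> F" "e \<subseteq> V" "f \<subseteq> V" "card e = 2" "card f = 2"
  shows "2 * p\<^sup>2 - p ^ card (e \<union> f) \<le> hit_weight p V F"
proof -
  have "2 * p\<^sup>2 - p ^ card (e \<union> f) = (\<Sum>U\<in>Pow V. survival_weight p V U *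
      (of_bool (e \<subseteq> U) + of_bool (f \<subseteq> U) - of_bool (e \<union> f \<subseteq> U)))"
    using assms sum_survival_weight_superset[of V e p] sum_survival_weight_superset[of V f p]
      sum_survival_weight_superset[of V "e \<union> f" p]
    by (simp only: distrib_left right_diff_distrib sum.distrib sum_subtractf) simp
  also have "\<dots> \<le> hit_weight p V F"
    unfolding hit_weight_def using assms
    by (intro sum_mono mult_left_mono survival_weight_nonneg) auto
  finally show ?thesis .
qed

text \<open>Two edges of a triangle survive together only if all three do, so subtracting twice the
  indicator of the whole triangle corrects the overcount.\<close>

lemma hit_weight_triangle:
  assumes "finite V" "0 \<le> p" "p \<le> 1" "\<And>e. e \<in> F \<Longrightarrow> e \<subseteq> V"
    and "x \<noteq> y" "y \<noteq> z" "x \<noteq> z" "{x, y} \<in> F" "{y, z} \<in> F" "{x, z} \<in> F"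
  shows "3 * p\<^sup>2 - 2 * p ^ 3 \<le> hit_weight p V F"
proof -
  have V: "{x, y} \<subseteq> V" "{y, z} \<subseteq> V" "{x, z} \<subseteq> V" "{x, y, z} \<subseteq> V" using assms by auto
  have "3 * p\<^sup>2 - 2 * p ^ 3 = (\<Sum>U\<in>Pow V. survival_weight p V U *
      (of_bool ({x, y} \<subseteq> U) + of_bool ({y, z} \<subseteq> U) + of_bool ({x, z} \<subseteq> U) -
       of_bool ({x, y, z} \<subseteq> U) - of_bool ({x, y, z} \<subseteq> U)))"
    using V[THEN sum_survival_weight_superset[OF assms(1)], of p] assms(5-7)
    by (simp only: distrib_left right_diff_distrib sum.distrib sum_subtractf)
      (simp add: power2_eq_square power3_eq_cube)
  also have "\<dots> \<le> hit_weight p V F"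
    unfolding hit_weight_def using assms(2,3)
    by (intro sum_mono mult_left_mono survival_weight_nonneg)
      (auto intro: bexI[OF _ assms(8)] bexI[OF _ assms(9)] bexI[OF _ assms(10)])
  finally show ?thesis .
qed

text \<open>Two distinct edges span at least three vertices, so with \<open>p \<le> 1\<close> the
  incident pair is the worst case.\<close>

lemma hit_weight_general:
  assumes "finite V" "0 \<le> p" "p \<le> 1" "\<And>e. e \<in> F \<Longrightarrow> e \<subseteq> V \<and> card e = 2" "2 \<le> card F"
  shows "2 * p\<^sup>2 - p ^ 3 \<le> hit_weight p V F"
proof -
  have "finite F" using assms(5) by (metis card.infinite not_numeral_le_zero)
  then obtain e f where ef: "e \<in> F" "f \<in> F" "e \<noteq> f"
    using assms(5) by (metis card_le_Suc0_iff_eq not_less_eq_eq numeral_2_eq_2)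
  have fin: "finite e" "finite f" using assms(1,4) ef by (meson finite_subset)+
  have "card (e \<union> f) \<noteq> 2"
    using ef assms(4) fin by (metis card_subset_eq finite_UnI sup_ge1 sup_ge2)
  moreover have "2 \<le> card (e \<union> f)"
    using assms(4)[OF ef(1)] fin by (metis card_mono finite_UnI sup_ge1)
  ultimately have "p ^ card (e \<union> f) \<le> p ^ 3"
    using assms(2,3) by (intro power_decreasing) auto
  then show ?thesis
    using hit_weight_two_edges[of V p e F f] assms ef by fastforce
qed

text \<open>A matching spans four vertices. A triangle does at least as well, by a margin of
  \<open>(p * (1 - p))\<^sup>2\<close>. The gain over the general bound is
  \<open>p ^ 3 - p ^ 4\<close>.\<close>

lemma hit_weight_good:
  assumes "finite V" "0 \<le> p" "p \<le> 1" "\<And>e. e \<in> F \<Longrightarrow> e \<subseteq> V \<and> card e = 2"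
    and "contains_matching_of_size_two F \<or> contains_triangle F"
  shows "2 * p\<^sup>2 - p ^ 4 \<le> hit_weight p V F"
  using assms(5)
proof
  assume "contains_matching_of_size_two F"
  then obtain e f where ef: "e \<in> F" "f \<in> F" "e \<inter> f = {}"
    by (auto simp: contains_matching_of_size_two_def)
  then have "card (e \<union> f) = 4"
    using assms(4)[of e] assms(4)[of f] assms(1)
    by (subst card_Un_disjoint) (auto intro: finite_subset)
  then show ?thesis
    using hit_weight_two_edges[of V p e F f] assms ef by fastforce
next
  assume "contains_triangle F"
  then obtain x y z where "x \<noteq> y" "y \<noteq> z" "x \<noteq> z" "{x, y} \<in> F" "{y, z} \<in> F" "{x, z} \<in> F"
    unfolding contains_triangle_def by blast
  then have "3 * p\<^sup>2 - 2 * p ^ 3 \<le> hit_weight p V F"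
    using assms by (intro hit_weight_triangle[of V p F x y z]) auto
  moreover have "3 * p\<^sup>2 - 2 * p ^ 3 - (2 * p\<^sup>2 - p ^ 4) = (p * (1 - p))\<^sup>2"
    by (simp add: algebra_simps power2_eq_square power3_eq_cube power4_eq_xxxx)
  then have "2 * p\<^sup>2 - p ^ 4 \<le> 3 * p\<^sup>2 - 2 * p ^ 3"
    by (metis diff_ge_0_iff_ge zero_le_power2)
  ultimately show ?thesis by linarith
qed

text \<open>First-moment argument. With as many colors as vertices, the general bound loses
  \<open>p * (1 - p)\<^sup>2\<close> per color against the survival probability \<open>p\<close> of
  a vertex, while each color in \<open>J\<close> gains \<open>p ^ 3 * (1 - p)\<close>. The net
  expected excess is the stated one, and some \<open>U\<close> attains the average.\<close>

lemma exists_color_rich_vertex_set: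
  fixes F :: "'i \<Rightarrow> 'a set set"
  assumes V: "finite V" and p: "0 \<le> p" "p \<le> 1" and I: "finite I" "J \<subseteq> I" "card I = card V"
    and F: "\<And>i e. i \<in> I \<Longrightarrow> e \<in> F i \<Longrightarrow> e \<subseteq> V \<and> card e = 2" "\<And>i. i \<in> I \<Longrightarrow> 2 \<le> card (F i)"
    and J: "\<And>i. i \<in> J \<Longrightarrow> contains_matching_of_size_two (F i) \<or> contains_triangle (F i)"
    and a: "a * real (card V) \<le> real (card J)"
  shows "\<exists>U\<subseteq>V. real (card U) + p * (1 - p) * (a * p\<^sup>2 - (1 - p)) * real (card V)
      \<le> real (card {i \<in> I. \<exists>e\<in>F i. e \<subseteq> U})"
proof (rule ccontr)
  define d where "d = p * (1 - p) * (a * p\<^sup>2 - (1 - p)) * real (card V)"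
  let ?X = "\<lambda>U. real (card {i \<in> I. \<exists>e\<in>F i. e \<subseteq> U})"
  assume "\<not> ?thesis"
  then have less: "?X U < real (card U) + d" if "U \<subseteq> V" for U
    using that by (auto simp: d_def not_le)
  have total: "(\<Sum>U\<in>Pow V. survival_weight p V U) = 1"
    using sum_survival_weight_superset[OF V, of "{}" p] by simp
  \<comment> \<open>The expected number of surviving colors, summed color by color.\<close>
  have swap: "(\<Sum>U\<in>Pow V. survival_weight p V U * ?X U) = (\<Sum>i\<in>I. hit_weight p V (F i))"
  proof -
    have "?X U = (\<Sum>i\<in>I. of_bool (\<exists>e\<in>F i. e \<subseteq> U))" for U
      using I(1) by (simp add: of_bool_def sum.If_cases Int_def)
    then have "(\<Sum>U\<in>Pow V. survival_weight p V U * ?X U) =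
        (\<Sum>U\<in>Pow V. \<Sum>i\<in>I. survival_weight p V U * of_bool (\<exists>e\<in>F i. e \<subseteq> U))"
      by (simp only: sum_distrib_left)
    also have "\<dots> = (\<Sum>i\<in>I. hit_weight p V (F i))"
      unfolding hit_weight_def by (rule sum.swap)
    finally show ?thesis .
  qed
  have "real (card V) * (2 * p\<^sup>2 - p ^ 3) + real (card J) * (p ^ 3 - p ^ 4) =
      (\<Sum>i\<in>I. 2 * p\<^sup>2 - p ^ 3 + (if i \<in> J then p ^ 3 - p ^ 4 else 0))"
    using I by (simp add: sum.distrib sum.If_cases Int_absorb1)
  also have "\<dots> \<le> (\<Sum>i\<in>I. hit_weight p V (F i))"
  proof (rule sum_mono)
    fix i assume i: "i \<in> I"
    show "2 * p\<^sup>2 - p ^ 3 + (if i \<in> J then p ^ 3 - p ^ 4 else 0) \<le> hit_weight p V (F i)"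
      using hit_weight_general[OF V p F(1)[OF i] F(2)[OF i]]
        hit_weight_good[OF V p F(1)[OF i] J] by auto
  qed
  finally have lower: "real (card V) * (2 * p\<^sup>2 - p ^ 3) + real (card J) * (p ^ 3 - p ^ 4)
      \<le> (\<Sum>i\<in>I. hit_weight p V (F i))" .
  have "p ^ 4 \<le> p ^ 3" using p by (intro power_decreasing) auto
  then have "a * real (card V) * (p ^ 3 - p ^ 4) \<le> real (card J) * (p ^ 3 - p ^ 4)"
    using a by (intro mult_right_mono) auto
  moreover have "p * real (card V) + d =
      real (card V) * (2 * p\<^sup>2 - p ^ 3) + a * real (card V) * (p ^ 3 - p ^ 4)"
    unfolding d_def by (simp add: algebra_simps power2_eq_square power3_eq_cube power4_eq_xxxx)
  ultimately have "p * real (card V) + d \<le> (\<Sum>U\<in>Pow V. survival_weight p V U * ?X U)"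
    using lower swap by linarith
  moreover have "(\<Sum>U\<in>Pow V. survival_weight p V U * (real (card U) + d)) = p * real (card V) + d"
    using sum_survival_weight_card[OF V, of p] total
    by (simp add: distrib_left sum.distrib flip: sum_distrib_right)
  ultimately have ge: "(\<Sum>U\<in>Pow V. survival_weight p V U * (real (card U) + d - ?X U)) \<le> 0"
    by (simp add: right_diff_distrib sum_subtractf)
  \<comment> \<open>Under the contrary assumption every gap is strictly positive, so a nonpositive
    weighted sum forces all weights to vanish, although they add up to 1.\<close>
  have nonneg: "0 \<le> survival_weight p V U * (real (card U) + d - ?X U)" if "U \<in> Pow V" for U
    using that less[of U] survival_weight_nonneg[OF p, of V U] by (intro mult_nonneg_nonneg) auto
  then have "\<forall>U\<in>Pow V. survival_weight p V U * (real (card U) + d - ?X U) = 0"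
    using ge V sum_nonneg[of "Pow V" "\<lambda>U. survival_weight p V U * (real (card U) + d - ?X U)"]
      sum_nonneg_eq_0_iff[of "Pow V" "\<lambda>U. survival_weight p V U * (real (card U) + d - ?X U)"]
    by fastforce
  then have "survival_weight p V U = 0" if "U \<in> Pow V" for U
    using less[of U] that by fastforce
  then show False using total by simp
qed

section \<open>Choice of the constants and extraction of a short rainbow cycle\<close>

theorem theorem1p11:
  fixes \<alpha> :: real
  assumes "\<alpha> > 0"
  shows "\<exists>C::real. C > 0 \<and>
    (\<forall>(n::nat) (V :: 'a set) (E :: 'a set set) (col :: 'a set \<Rightarrow> nat).
       finite_simple_graph V E \<and> card V = n \<and>
       edge_coloring E n col \<and>
       (\<forall>i\<in>{1..n}. card (color_class E col i) \<ge> 2) \<and>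
       real (card {i \<in> {1..n}. contains_matching_of_size_two (color_class E col i) \<or>
                               contains_triangle (color_class E col i)}) \<ge> \<alpha> * real n
       \<longrightarrow> ereal_of_enat (rainbow_girth E col) \<le> ereal (C * ln (real n)))"
proof -
  \<comment> \<open>Capping at 1 keeps \<open>p \<ge> 3 / 4\<close>. The deletion probability
    \<open>a / 4\<close> then lies below \<open>9 * a / 16 \<le> a * p\<^sup>2\<close>, which makes
    \<open>\<epsilon>\<close> positive.\<close>
  define a where "a = min \<alpha> 1"
  define p where "p = 1 - a / 4"
  have a: "0 < a" "a \<le> 1" "a \<le> \<alpha>" using assms by (auto simp: a_def)
  have p: "3 / 4 \<le> p" "p < 1" using a by (auto simp: p_def)
  define \<epsilon> where "\<epsilon> = p * (1 - p) * (a * p\<^sup>2 - (1 - p))"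
  have "(3 / 4)\<^sup>2 \<le> p\<^sup>2" using p by (intro power_mono) auto
  then have "a * (3 / 4)\<^sup>2 \<le> a * p\<^sup>2" using a by (intro mult_left_mono) auto
  moreover have "1 - p < a * (3 / 4)\<^sup>2" using a by (simp add: p_def power2_eq_square)
  ultimately have "0 < a * p\<^sup>2 - (1 - p)" by linarith
  then have \<epsilon>: "0 < \<epsilon>" using p by (simp add: \<epsilon>_def)
  have ln\<epsilon>: "0 < ln (1 + \<epsilon>)" using \<epsilon> by simp
  \<comment> \<open>The cycle will have length at most
    \<open>2 * ln n / ln (1 + \<epsilon>) + 3\<close>; the second summand of \<open>C\<close>
    absorbs the 3 because \<open>n \<ge> 2\<close>.\<close>
  define C where "C = 2 / ln (1 + \<epsilon>) + 3 / ln 2"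
  have C: "0 < C" using ln\<epsilon> by (simp add: C_def add_pos_pos)
  have "ereal_of_enat (rainbow_girth E col) \<le> ereal (C * ln (real n))"
    if G: "finite_simple_graph V E" "card V = n" "edge_coloring E n col"
      and two: "\<And>i. i \<in> {1..n} \<Longrightarrow> card (color_class E col i) \<ge> 2"
      and many: "real (card {i \<in> {1..n}. contains_matching_of_size_two (color_class E col i) \<or>
         contains_triangle (color_class E col i)}) \<ge> \<alpha> * real n"
    for n :: nat and V :: "'a set" and E :: "'a set set" and col :: "'a set \<Rightarrow> nat"
  proof -
    have V: "finite V" "V \<noteq> {}" and E: "\<And>e. e \<in> E \<Longrightarrow> e \<subseteq> V \<and> card e = 2"
      using G by (auto simp: finite_simple_graph_def)
    \<comment> \<open>A nonempty \<open>V\<close> guarantees that color 1 exists; its class supplies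
      an edge, hence two vertices.\<close>
    have "0 < n" using V G(2) by (auto simp: card_gt_0_iff)
    then have "color_class E col 1 \<noteq> {}" using two[of 1] by auto
    then obtain e where "e \<in> E" by (auto simp: color_class_def)
    then have n: "2 \<le> n" using E V G(2) card_mono by metis
    have "a * real n \<le> \<alpha> * real n" using a by (intro mult_right_mono) auto
    define J where "J = {i \<in> {1..n}. contains_matching_of_size_two (color_class E col i) \<or>
         contains_triangle (color_class E col i)}"
    have good: "a * real (card V) \<le> real (card J)"
      using \<open>a * real n \<le> \<alpha> * real n\<close> many unfolding G(2) J_def by (rule order_trans)
    have J: "J \<subseteq> {1..n}" "\<And>i. i \<in> J \<Longrightarrow> contains_matching_of_size_two (color_class E col i) \<or>
        contains_triangle (color_class E col i)"
      by (auto simp: J_def)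
    have edges: "e \<subseteq> V \<and> card e = 2" if "e \<in> color_class E col i" for i e
      using that E by (simp add: color_class_def)
    have "\<exists>U\<subseteq>V. real (card U) + p * (1 - p) * (a * p\<^sup>2 - (1 - p)) * real (card V)
        \<le> real (card {i \<in> {1..n}. \<exists>e\<in>color_class E col i. e \<subseteq> U})"
      using p G(2) J(1)
      by (intro exists_color_rich_vertex_set[where J = J, OF V(1) _ _ _ _ _ edges two J(2) good]) auto
    then obtain U where U: "U \<subseteq> V" and rich: "real (card U) + \<epsilon> * real n
        \<le> real (card {i \<in> {1..n}. \<exists>e\<in>color_class E col i. e \<subseteq> U})"
      unfolding \<epsilon>_def[symmetric] G(2) by blast
    define I where "I = {i \<in> {1..n}. \<exists>e\<in>color_class E col i. e \<subseteq> U}"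
    \<comment> \<open>One representative edge per surviving color makes every subgraph of
      \<open>F\<close> rainbow.\<close>
    have "\<forall>i\<in>I. \<exists>e. e \<in> E \<and> col e = i \<and> e \<subseteq> U"
      by (auto simp: I_def color_class_def)
    then obtain g where g: "\<And>i. i \<in> I \<Longrightarrow> g i \<in> E \<and> col (g i) = i \<and> g i \<subseteq> U"
      by (meson bchoice)
    have inj: "inj_on g I" by (metis g inj_onI)
    define F where "F = g ` I"
    have FE: "F \<subseteq> E" using g by (auto simp: F_def)
    have F: "e \<subseteq> U \<and> card e = 2" if "e \<in> F" for e using that E g by (auto simp: F_def)
    have finU: "finite U" using U V(1) finite_subset by blast
    have colF: "inj_on col F" using g by (auto simp: F_def inj_on_def)
    have cardF: "card F = card I" using inj by (simp add: F_def card_image)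
    have cardU: "card U \<le> n" using U V G(2) card_mono by metis
    \<comment> \<open>Floor plus one, so that \<open>(1 + \<epsilon>) ^ r\<close> strictly exceeds
      \<open>n\<close>.\<close>
    define r where "r = nat \<lfloor>ln (real n) / ln (1 + \<epsilon>)\<rfloor> + 1"
    have r: "ln (real n) / ln (1 + \<epsilon>) < real r" "real r \<le> ln (real n) / ln (1 + \<epsilon>) + 1"
      using n ln\<epsilon> by (auto simp: r_def) linarith+
    have "ln (real n) < ln ((1 + \<epsilon>) ^ r)"
      using r(1) ln\<epsilon> \<epsilon> by (simp add: ln_realpow field_simps)
    then have big: "real (card U) < (1 + \<epsilon>) ^ r"
      using n \<epsilon> cardU by (subst (asm) ln_less_cancel_iff) auto
    \<comment> \<open>The additive excess \<open>\<epsilon> * n\<close> becomes a multiplicative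
      one.\<close>
    have "\<epsilon> * real (card U) \<le> \<epsilon> * real n" using \<epsilon> cardU by simp
    then have dense: "(1 + \<epsilon>) * real (card U) \<le> real (card F)"
      using rich cardF by (simp add: I_def algebra_simps)
    \<comment> \<open>Nonemptiness comes from the additive bound, as \<open>dense\<close> alone
      would allow \<open>U\<close> and \<open>F\<close> both empty.\<close>
    have "0 < \<epsilon> * real n" using \<epsilon> n by simp
    then have "0 < real (card F)" using rich unfolding I_def[symmetric] cardF by linarith
    then have "F \<noteq> {}" by auto
    then obtain vs where vs: "is_cycle F vs" "length vs \<le> 2 * r + 1"
      using dense_graph_has_short_cycle[OF finU F _ dense _ big] \<epsilon> by auto
    have "is_cycle E vs" using vs(1) FE by (auto simp: is_cycle_def)
    moreover have "rainbow col (cycle_edges vs)"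
      using vs(1) inj_on_subset[OF colF] by (simp add: is_cycle_def rainbow_def)
    ultimately have "rainbow_girth E col \<le> enat (length vs)"
      unfolding rainbow_girth_def by (intro Inf_lower) blast
    then have "ereal_of_enat (rainbow_girth E col) \<le> ereal_of_enat (enat (length vs))"
      by (simp only: ereal_of_enat_le_iff)
    also have "\<dots> = ereal (real (length vs))" by simp
    also have "\<dots> \<le> ereal (C * ln (real n))"
    proof -
      have "real (length vs) \<le> 2 * real r + 1" using vs(2) by linarith
      moreover have "3 \<le> 3 / ln 2 * ln (real n)" using n by (simp add: field_simps)
      moreover have "C * ln (real n) = 2 * (ln (real n) / ln (1 + \<epsilon>)) + 3 / ln 2 * ln (real n)"
        by (simp add: C_def distrib_right)
      ultimately have "real (length vs) \<le> C * ln (real n)"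
        using r(2) by linarith
      then show ?thesis by simp
    qed
    finally show ?thesis .
  qed
  then show ?thesis using C by blast
qed

end
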